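(* Let $G\subset\mathbb{R}^3$ be a bounded domain, let $L>0$ be its length scale ($\mathrm{vol}(G)\sim L^3$), let $u=(u_1,u_2,u_3)\in\mathbb{R}^3\setminus\{0\}$ be a constant vector, and let $A\neq0$, $\mathsf{RE}_*>0$, $T>0$ and $\beta\le\tfrac12$ be real constants. Let $\mathscr{T}(x)=\sum_{I\ge1}Z_I^{1/2}f_I(x)\xi_I$ be a centred Gaussian random field on $G$ with its Karhunen-Loeve expansion as described in the context. For each $\nu>0$ with $\mathsf{RE}:=\|u\|L/\nu>\mathsf{RE}_*$ define $$\mathscr{U}_a(x)=u_a+A\,u_a\,(\mathsf{RE}-\mathsf{RE}_* )^{\beta}\sum_{I=1}^{\infty}Z_I^{1/2}f_I(x)\,\xi_I ,\qquad a=1,2,3.$$ Then, with $u$ and $L$ fixed, the anomalous dissipation law $$\lim_{\nu\to0^+}\nu\,\mathbb{E}\Big[\sum_{a,b}|\nabla_b\mathscr{U}_a(x)|^2\Big]>0\quad (x\in G),$$ or, in integrated form, $$\lim_{\nu\to0^+}\nu\int_G\mathbb{E}\Big[\sum_{a,b}|\nabla_b\mathscr{U}_a(x)|^2\Big]dx=A^2\|u\|^3L\sum_{I=1}^\infty Z_I\int_G|\nabla f_I(x)|^2dx>0,$$ or $$\lim_{\nu\to0^+}\nu\int_0^T\!\!\int_G\mathbb{E}\Big[\sum_{a,b}|\nabla_b\mathscr{U}_a(x)|^2\Big]dx\,ds=A^2\|u\|^3L\,T\sum_{I=1}^\infty Z_I\int_G|\nabla f_I(x)|^2dx>0,$$ holds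 if and only if $\beta=\tfrac12$ and $0<\sum_{I=1}^\infty Z_I\int_G|\nabla f_I(x)|^2\,dx<\infty$.
   Context: Notation: $\nabla_b=\partial/\partial x_b$, $\|\cdot\|$ is the Euclidean norm on $\mathbb{R}^3$, $\mathbb{E}$ is expectation; $\nu$ is the viscosity, $\mathsf{RE}$ the Reynolds number and $\mathsf{RE}_*$ a critical Reynolds number. Gaussian random field and Karhunen-Loeve expansion: $\mathscr{T}$ is a centred Gaussian random field on $G$ with $\mathbb{E}[\mathscr{T}(x)\mathscr{T}(y)]=K(x,y;\lambda)$, where $K$ is stationary and isotropic (depends only on $\|x-y\|$), has correlation length $\lambda>0$, and is regulated ($K(x,x;\lambda)<\infty$). Its eigenvalues $Z_I>0$ and real eigenfunctions $f_I$ satisfy $\int_G K(x,y;\lambda)f_I(y)\,dy=Z_If_I(x)$, $\int_G f_If_J\,dx=\delta_{IJ}$, and $\{f_I\}$ is complete in $L^2(G)$. The $\xi_I$ are independent standard Gaussian random variables ($\mathbb{E}[\xi_I]=0$, $\mathbb{E}[\xi_I\xi_J]=\delta_{IJ}$), and the expansion converges in mean square. The field is mean-square differentiable, the $f_I$ are differentiable, and derivatives are taken term by term: $\nabla_b\mathscr{T}=\sum_I Z_I^{1/2}\nabla_b f_I\,\xi_I$. *)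

theory Defs
  imports "HOL-Probability.Probability"
begin

definition partial :: "3 \<Rightarrow> (real^3 \<Rightarrow> real) \<Rightarrow> real^3 \<Rightarrow> real" where
  "partial b g x = frechet_derivative g (at x) (axis b 1)"

definition grad :: "(real^3 \<Rightarrow> real) \<Rightarrow> real^3 \<Rightarrow> real^3" where
  "grad g x = (\<chi> b. partial b g x)"

definition L2_on :: "(real^3) set \<Rightarrow> (real^3 \<Rightarrow> real) \<Rightarrow> bool" where
  "L2_on G g \<longleftrightarrow> set_borel_measurable lborel G g \<and> set_integrable lborel G (\<lambda>x. (g x)\<^sup>2)"

definition L2_inner :: "(real^3) set \<Rightarrow> (real^3 \<Rightarrow> real) \<Rightarrow> (real^3 \<Rightarrow> real) \<Rightarrow> real" where
  "L2_inner G g h = (LINT x:G|lborel. g x * h x)"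

definition orthonormal_L2 :: "(real^3) set \<Rightarrow> (nat \<Rightarrow> real^3 \<Rightarrow> real) \<Rightarrow> bool" where
  "orthonormal_L2 G f \<longleftrightarrow> (\<forall>I. L2_on G (f I)) \<and>
     (\<forall>I J. L2_inner G (f I) (f J) = (if I = J then 1 else 0))"

text \<open>Completeness of an orthonormal system: every square-integrable function is the
  limit in quadratic mean of its Fourier series.\<close>

definition complete_L2 :: "(real^3) set \<Rightarrow> (nat \<Rightarrow> real^3 \<Rightarrow> real) \<Rightarrow> bool" where
  "complete_L2 G f \<longleftrightarrow> (\<forall>g. L2_on G g \<longrightarrow>
     (\<lambda>n. LINT x:G|lborel. (g x - (\<Sum>I<n. L2_inner G g (f I) * f I x))\<^sup>2) \<longlonglongrightarrow> 0)"

definition second_order :: "'w measure \<Rightarrow> ('w \<Rightarrow> real) \<Rightarrow> bool" where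
  "second_order M X \<longleftrightarrow> X \<in> borel_measurable M \<and> integrable M (\<lambda>\<omega>. (X \<omega>)\<^sup>2)"

definition has_ms_sum :: "'w measure \<Rightarrow> (nat \<Rightarrow> 'w \<Rightarrow> real) \<Rightarrow> ('w \<Rightarrow> real) \<Rightarrow> bool" where
  "has_ms_sum M X S \<longleftrightarrow> (\<forall>I. second_order M (X I)) \<and> second_order M S \<and>
     (\<lambda>n. LINT \<omega>|M. (S \<omega> - (\<Sum>I<n. X I \<omega>))\<^sup>2) \<longlonglongrightarrow> 0"

text \<open>Mean-square limits are unique only up to null sets, and the two operators below pick a
  representative. Nothing that is later formed from them (mean-square limits, expectations)
  depends on the choice.\<close>

definition ms_suminf :: "'w measure \<Rightarrow> (nat \<Rightarrow> 'w \<Rightarrow> real) \<Rightarrow> 'w \<Rightarrow> real" where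
  "ms_suminf M X = (SOME S. has_ms_sum M X S)"

definition has_ms_partial ::
  "'w measure \<Rightarrow> (real^3 \<Rightarrow> 'w \<Rightarrow> real) \<Rightarrow> 3 \<Rightarrow> real^3 \<Rightarrow> ('w \<Rightarrow> real) \<Rightarrow> bool" where
  "has_ms_partial M X b x D \<longleftrightarrow> second_order M D \<and> second_order M (X x) \<and>
     (\<forall>\<^sub>F h in at 0. second_order M (X (x + h *\<^sub>R axis b 1))) \<and>
     ((\<lambda>h. LINT \<omega>|M. ((X (x + h *\<^sub>R axis b 1) \<omega> - X x \<omega>) / h - D \<omega>)\<^sup>2) \<longlongrightarrow> 0) (at 0)"

definition ms_partial ::
  "'w measure \<Rightarrow> (real^3 \<Rightarrow> 'w \<Rightarrow> real) \<Rightarrow> 3 \<Rightarrow> real^3 \<Rightarrow> 'w \<Rightarrow> real" where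
  "ms_partial M X b x = (SOME D. has_ms_partial M X b x D)"

text \<open>Point masses count as (degenerate) Gaussian laws.\<close>

definition gaussian_rv :: "'w measure \<Rightarrow> ('w \<Rightarrow> real) \<Rightarrow> bool" where
  "gaussian_rv M X \<longleftrightarrow>
     (\<exists>\<mu> \<sigma>. 0 < \<sigma> \<and> distributed M lborel X (\<lambda>t. ennreal (normal_density \<mu> \<sigma> t))) \<or>
     (X \<in> borel_measurable M \<and> (\<exists>\<mu>. AE \<omega> in M. X \<omega> = \<mu>))"

definition gaussian_field :: "'w measure \<Rightarrow> 'p set \<Rightarrow> ('p \<Rightarrow> 'w \<Rightarrow> real) \<Rightarrow> bool" where
  "gaussian_field M G X \<longleftrightarrow>
     (\<forall>F c. finite F \<and> F \<subseteq> G \<longrightarrow> gaussian_rv M (\<lambda>\<omega>. \<Sum>x\<in>F. c x * X x \<omega>))"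

text \<open>A centred Gaussian random field \<open>X\<close> on \<open>G\<close> with covariance \<open>K lam\<close>, and its
  Karhunen-Loeve expansion with eigenvalues \<open>Z\<close>, eigenfunctions \<open>f\<close> and coefficients \<open>\<xi>\<close>,
  numbered from 0. The correlation length \<open>lam\<close> enters only as the parameter of the kernel. Since
  \<open>K\<close> is real-valued, the regulatedness condition \<open>K lam x x < \<infinity>\<close> is automatic.\<close>

locale kl_gaussian_field = prob_space M for M :: "'w measure" +
  fixes G :: "(real^3) set"
    and K :: "real \<Rightarrow> real^3 \<Rightarrow> real^3 \<Rightarrow> real"
    and lam :: real
    and Z :: "nat \<Rightarrow> real"
    and f :: "nat \<Rightarrow> real^3 \<Rightarrow> real"
    and \<xi> :: "nat \<Rightarrow> 'w \<Rightarrow> real"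
    and X :: "real^3 \<Rightarrow> 'w \<Rightarrow> real"
  assumes lam_pos: "lam > 0"
    and isotropic: "\<exists>k. \<forall>x\<in>G. \<forall>y\<in>G. K lam x y = k (norm (x - y))"
    and gaussian: "gaussian_field M G X"
    and centred: "\<And>x. x \<in> G \<Longrightarrow> expectation (X x) = 0"
    and covariance: "\<And>x y. x \<in> G \<Longrightarrow> y \<in> G \<Longrightarrow> expectation (\<lambda>\<omega>. X x \<omega> * X y \<omega>) = K lam x y"
    and eigenvalue_pos: "\<And>I. Z I > 0"
    and eigen_integrable: "\<And>I x. x \<in> G \<Longrightarrow> set_integrable lborel G (\<lambda>y. K lam x y * f I y)"
    and eigen_equation: "\<And>I x. x \<in> G \<Longrightarrow> (LINT y:G|lborel. K lam x y * f I y) = Z I * f I x"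
    and orthonormal: "orthonormal_L2 G f"
    and complete: "complete_L2 G f"
    and eigenfunction_diff: "\<And>I x. x \<in> G \<Longrightarrow> f I differentiable (at x)"
    and \<xi>_indep: "indep_vars (\<lambda>_. borel) \<xi> UNIV"
    and \<xi>_normal: "\<And>I. distributed M lborel (\<xi> I) (\<lambda>t. ennreal (std_normal_density t))"
    and expansion: "\<And>x. x \<in> G \<Longrightarrow> has_ms_sum M (\<lambda>I \<omega>. sqrt (Z I) * f I x * \<xi> I \<omega>) (X x)"
    and termwise_derivative: "\<And>x b. x \<in> G \<Longrightarrow> \<exists>D. has_ms_partial M X b x D \<and>
           has_ms_sum M (\<lambda>I \<omega>. sqrt (Z I) * partial b (f I) x * \<xi> I \<omega>) D"

definition reynolds :: "real^3 \<Rightarrow> real \<Rightarrow> real \<Rightarrow> real" where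
  "reynolds u L \<nu> = norm u * L / \<nu>"

text \<open>The velocity field is meaningful for \<open>x \<in> G\<close> and \<open>RE > REc\<close>, where \<open>REc\<close> is the critical
  Reynolds number; then the base of the real power is positive.\<close>

definition turbulent_velocity ::
  "'w measure \<Rightarrow> (nat \<Rightarrow> real) \<Rightarrow> (nat \<Rightarrow> real^3 \<Rightarrow> real) \<Rightarrow> (nat \<Rightarrow> 'w \<Rightarrow> real) \<Rightarrow> real^3 \<Rightarrow> real \<Rightarrow>
     real \<Rightarrow> real \<Rightarrow> real \<Rightarrow> 3 \<Rightarrow> real^3 \<Rightarrow> 'w \<Rightarrow> real" where
  "turbulent_velocity M Z f \<xi> u A \<beta> REc RE a x \<omega> =
     u $ a + A * u $ a * (RE - REc) powr \<beta> *
       ms_suminf M (\<lambda>I \<omega>. sqrt (Z I) * f I x * \<xi> I \<omega>) \<omega>"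

text \<open>Expectation of the sum over \<open>a\<close>, \<open>b\<close> of the squared mean-square derivatives of the components of
  the vector field \<open>V\<close>. It and its integrals are taken in \<open>[0, \<infinity>]\<close>, so that no value arises from a
  failure of integrability.\<close>

definition mean_grad_sq :: "'w measure \<Rightarrow> (3 \<Rightarrow> real^3 \<Rightarrow> 'w \<Rightarrow> real) \<Rightarrow> real^3 \<Rightarrow> ennreal" where
  "mean_grad_sq M V x =
     (\<integral>\<^sup>+ \<omega>. ennreal (\<Sum>a\<in>UNIV. \<Sum>b\<in>UNIV. \<bar>ms_partial M (V a) b x \<omega>\<bar>\<^sup>2) \<partial>M)"

definition kl_grad_energy ::
  "(real^3) set \<Rightarrow> (nat \<Rightarrow> real) \<Rightarrow> (nat \<Rightarrow> real^3 \<Rightarrow> real) \<Rightarrow> ennreal" where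
  "kl_grad_energy G Z f =
     (\<Sum>I. ennreal (Z I) * (\<integral>\<^sup>+ x\<in>G. ennreal ((norm (grad (f I) x))\<^sup>2) \<partial>lborel))"

end

theory Submission
  imports Defs
begin

text \<open>
  Because the covariance is stationary and isotropic, every mean-square partial derivative of the
  field has one and the same variance \<open>q\<close>, at all points of \<open>G\<close> and in all directions. Hence
  \<open>\<Sum>I. Z I * (norm (grad (f I) x))\<^sup>2 = 3 * q\<close> on \<open>G\<close>, and the gradient energy equals \<open>3 * q * vol G\<close>,
  which is finite since \<open>G\<close> is bounded. The mean squared gradient of the velocity at a point is
  \<open>A\<^sup>2 * (norm u)\<^sup>2 * 3 * q * (RE - REc) powr (2 * \<beta>)\<close>, so that each of the three laws is decided by
  \<open>\<nu> * (norm u * L / \<nu> - REc) powr (2 * \<beta>)\<close>, which tends to \<open>norm u * L\<close> if \<open>\<beta> = 1/2\<close> and to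
  \<open>0\<close> if \<open>\<beta> < 1/2\<close>.
\<close>

section \<open>Square-integrable random variables and mean-square convergence\<close>

lemma second_order_borel_measurable [measurable_dest]: "second_order M X \<Longrightarrow> X \<in> borel_measurable M"
  by (simp add: second_order_def)

lemma second_order_square_integrable: "second_order M X \<Longrightarrow> integrable M (\<lambda>\<omega>. (X \<omega>)\<^sup>2)"
  by (simp add: second_order_def)

lemma second_order_mult_integrable:
  assumes X [measurable]: "second_order M X" and Y [measurable]: "second_order M Y"
  shows "integrable M (\<lambda>\<omega>. X \<omega> * Y \<omega>)"
proof (rule Bochner_Integration.integrable_bound)
  show "integrable M (\<lambda>\<omega>. (X \<omega>)\<^sup>2 + (Y \<omega>)\<^sup>2)"
    using X Y by (simp add: second_order_def)
  show "(\<lambda>\<omega>. X \<omega> * Y \<omega>) \<in> borel_measurable M"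
    by measurable
  have "\<bar>x * y\<bar> \<le> x\<^sup>2 + y\<^sup>2" for x y :: real
    using zero_le_power2[of "x + y"] zero_le_power2[of "x - y"] zero_le_power2[of x] zero_le_power2[of y]
    unfolding power2_sum power2_diff by linarith
  then show "AE \<omega> in M. norm (X \<omega> * Y \<omega>) \<le> norm ((X \<omega>)\<^sup>2 + (Y \<omega>)\<^sup>2)"
    by simp
qed

lemma second_order_cmult:
  assumes [measurable]: "second_order M X"
  shows "second_order M (\<lambda>\<omega>. c * X \<omega>)"
  using second_order_square_integrable[OF assms] by (simp add: second_order_def power_mult_distrib)

lemma second_order_add:
  assumes X [measurable]: "second_order M X" and Y [measurable]: "second_order M Y"
  shows "second_order M (\<lambda>\<omega>. X \<omega> + Y \<omega>)"
  using X Y second_order_mult_integrable[OF X Y]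
  by (simp add: second_order_def power2_sum mult.assoc)

lemma second_order_diff:
  assumes "second_order M X" "second_order M Y"
  shows "second_order M (\<lambda>\<omega>. X \<omega> - Y \<omega>)"
  using second_order_add[OF assms(1) second_order_cmult[OF assms(2), of "-1"]] by simp

lemma second_order_sum:
  "(\<And>i. i \<in> I \<Longrightarrow> second_order M (X i)) \<Longrightarrow> second_order M (\<lambda>\<omega>. \<Sum>i\<in>I. X i \<omega>)"
proof (induction I rule: infinite_finite_induct)
  case (insert i I)
  then show ?case by (simp add: second_order_add)
qed (simp_all add: second_order_def)

text \<open>The expectation of \<open>(t * X - Y)\<^sup>2\<close> is a quadratic polynomial in
  \<open>t\<close> that is nowhere negative; evaluating it at a suitable \<open>t\<close> bounds the
  mixed coefficient.\<close>

lemma second_order_cauchy_schwarz: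
  assumes X: "second_order M X" and Y: "second_order M Y"
  shows "(LINT \<omega>|M. X \<omega> * Y \<omega>)\<^sup>2 \<le> (LINT \<omega>|M. (X \<omega>)\<^sup>2) * (LINT \<omega>|M. (Y \<omega>)\<^sup>2)"
proof -
  define a b c where "a = (LINT \<omega>|M. (X \<omega>)\<^sup>2)" and "b = (LINT \<omega>|M. X \<omega> * Y \<omega>)"
    and "c = (LINT \<omega>|M. (Y \<omega>)\<^sup>2)"
  have quad: "0 \<le> t\<^sup>2 * a - 2 * t * b + c" for t
  proof -
    have "0 \<le> (LINT \<omega>|M. (t * X \<omega> - Y \<omega>)\<^sup>2)" by simp
    also have "\<dots> = (LINT \<omega>|M. t\<^sup>2 * (X \<omega>)\<^sup>2 - 2 * t * (X \<omega> * Y \<omega>) + (Y \<omega>)\<^sup>2)"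
      by (rule Bochner_Integration.integral_cong) (simp_all add: power2_eq_square algebra_simps)
    also have "\<dots> = t\<^sup>2 * a - 2 * t * b + c"
      using X Y second_order_mult_integrable[OF X Y]
      by (simp add: a_def b_def c_def second_order_def)
    finally show ?thesis .
  qed
  have a: "a \<ge> 0" by (simp add: a_def)
  have "b\<^sup>2 \<le> a * c"
  proof (cases "a = 0")
    case True
    have "b = 0"
    proof (rule ccontr)
      assume "b \<noteq> 0"
      \<comment> \<open>With \<open>a = 0\<close> the polynomial is the affine map
        \<open>c - 2 * t * b\<close>; this \<open>t\<close> is chosen to give it the value
        -1.\<close>
      then have "2 * ((c + 1) / (2 * b)) * b = c + 1" by simp
      then show False using quad[of "(c + 1) / (2 * b)"] True by simp
    qed
    then show ?thesis using True by simp
  next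
    case False
    \<comment> \<open>\<open>b / a\<close> is the minimiser of the quadratic.\<close>
    then show ?thesis
      using quad[of "b / a"] a by (simp add: field_simps power2_eq_square)
  qed
  then show ?thesis by (simp add: a_def b_def c_def)
qed

text \<open>Write \<open>Y h = D + (Y h - D)\<close> and expand the square: by Cauchy-Schwarz the
  cross term is controlled by the mean-square distance, which vanishes in the limit. A general
  filter covers both partial sums of series and difference quotients; the latter are known to be
  square integrable only for small \<open>h\<close>, whence the eventual hypothesis.\<close>

lemma second_order_norm_tendsto:
  assumes ev: "\<forall>\<^sub>F h in F. second_order M (Y h)" and D: "second_order M D"
    and lim: "((\<lambda>h. LINT \<omega>|M. (Y h \<omega> - D \<omega>)\<^sup>2) \<longlongrightarrow> 0) F"
  shows "((\<lambda>h. LINT \<omega>|M. (Y h \<omega>)\<^sup>2) \<longlongrightarrow> (LINT \<omega>|M. (D \<omega>)\<^sup>2)) F"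
proof -
  define e where "e h = (LINT \<omega>|M. (Y h \<omega> - D \<omega>)\<^sup>2)" for h
  define d where "d = (LINT \<omega>|M. (D \<omega>)\<^sup>2)"
  have bound: "\<bar>(LINT \<omega>|M. (Y h \<omega>)\<^sup>2) - d\<bar> \<le> e h + 2 * sqrt (d * e h)"
    if Y: "second_order M (Y h)" for h
  proof -
    have W: "second_order M (\<lambda>\<omega>. Y h \<omega> - D \<omega>)" using second_order_diff[OF Y D] .
    define p where "p = (LINT \<omega>|M. D \<omega> * (Y h \<omega> - D \<omega>))"
    have "(LINT \<omega>|M. (Y h \<omega>)\<^sup>2) =
        (LINT \<omega>|M. (Y h \<omega> - D \<omega>)\<^sup>2 + 2 * (D \<omega> * (Y h \<omega> - D \<omega>)) + (D \<omega>)\<^sup>2)"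
      by (rule Bochner_Integration.integral_cong) (simp_all add: power2_eq_square algebra_simps)
    also have "\<dots> = e h + 2 * p + d"
      using W D second_order_mult_integrable[OF D W]
      by (simp add: second_order_def e_def d_def p_def)
    finally have "(LINT \<omega>|M. (Y h \<omega>)\<^sup>2) = e h + 2 * p + d" .
    moreover have "\<bar>p\<bar> \<le> sqrt (d * e h)"
      using second_order_cauchy_schwarz[OF D W]
      by (intro real_le_rsqrt) (simp add: p_def d_def e_def)
    moreover have "e h \<ge> 0" by (simp add: e_def)
    ultimately show ?thesis by linarith
  qed
  have lim': "(e \<longlongrightarrow> 0) F" using lim by (simp add: e_def[abs_def])
  have "((\<lambda>h. e h + 2 * sqrt (d * e h)) \<longlongrightarrow> 0 + 2 * sqrt (d * 0)) F"
    by (intro tendsto_intros lim')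
  then have "((\<lambda>h. e h + 2 * sqrt (d * e h)) \<longlongrightarrow> 0) F"
    by simp
  moreover have "\<forall>\<^sub>F h in F. norm ((LINT \<omega>|M. (Y h \<omega>)\<^sup>2) - d) \<le> e h + 2 * sqrt (d * e h)"
    using ev by eventually_elim (simp add: bound)
  ultimately have "((\<lambda>h. (LINT \<omega>|M. (Y h \<omega>)\<^sup>2) - d) \<longlongrightarrow> 0) F"
    by (rule Lim_null_comparison[rotated])
  then show ?thesis by (simp add: d_def LIM_zero_iff)
qed

text \<open>Both limits are compared with the same partial sum, so their mean-square distance is
  bounded by a null sequence.\<close>

lemma has_ms_sum_AE_unique:
  assumes S: "has_ms_sum M X S" and S': "has_ms_sum M X S'"
  shows "AE \<omega> in M. S \<omega> = S' \<omega>"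
proof -
  have so: "second_order M S" "second_order M S'" "\<And>n. second_order M (\<lambda>\<omega>. \<Sum>I<n. X I \<omega>)"
    using S S' by (auto simp: has_ms_sum_def intro: second_order_sum)
  have d: "second_order M (\<lambda>\<omega>. S \<omega> - S' \<omega>)" using second_order_diff so by blast
  let ?a = "\<lambda>n. LINT \<omega>|M. (S \<omega> - (\<Sum>I<n. X I \<omega>))\<^sup>2"
  let ?b = "\<lambda>n. LINT \<omega>|M. (S' \<omega> - (\<Sum>I<n. X I \<omega>))\<^sup>2"
  have le: "(LINT \<omega>|M. (S \<omega> - S' \<omega>)\<^sup>2) \<le> 2 * ?a n + 2 * ?b n" for n
  proof -
    have i: "integrable M (\<lambda>\<omega>. (S \<omega> - (\<Sum>I<n. X I \<omega>))\<^sup>2)"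
      "integrable M (\<lambda>\<omega>. (S' \<omega> - (\<Sum>I<n. X I \<omega>))\<^sup>2)"
      using second_order_diff[OF so(1) so(3)[of n]] second_order_diff[OF so(2) so(3)[of n]]
      by (auto simp: second_order_def)
    \<comment> \<open>Parallelogram law: the two sides differ by exactly
      \<open>(s + s' - 2 * t)\<^sup>2\<close>.\<close>
    have "(s - s')\<^sup>2 \<le> 2 * (s - t)\<^sup>2 + 2 * (s' - t)\<^sup>2" for s s' t :: real
      using zero_le_power2[of "s + s' - 2 * t"] by (simp add: power2_eq_square algebra_simps)
    then have "(LINT \<omega>|M. (S \<omega> - S' \<omega>)\<^sup>2) \<le>
        (LINT \<omega>|M. 2 * (S \<omega> - (\<Sum>I<n. X I \<omega>))\<^sup>2 + 2 * (S' \<omega> - (\<Sum>I<n. X I \<omega>))\<^sup>2)"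
      using d i by (intro integral_mono) (auto simp: second_order_def)
    also have "\<dots> = 2 * ?a n + 2 * ?b n" using i by simp
    finally show ?thesis .
  qed
  have "(\<lambda>n. 2 * ?a n + 2 * ?b n) \<longlonglongrightarrow> 2 * 0 + 2 * 0"
    using S S' unfolding has_ms_sum_def by (intro tendsto_intros) auto
  then have "(LINT \<omega>|M. (S \<omega> - S' \<omega>)\<^sup>2) \<le> 2 * 0 + 2 * 0"
    by (rule LIMSEQ_le_const) (use le in blast)
  then have "(LINT \<omega>|M. (S \<omega> - S' \<omega>)\<^sup>2) = 0"
    by (simp add: order_antisym)
  then show ?thesis
    using d by (simp add: second_order_def integral_nonneg_eq_0_iff_AE)
qed

lemma ms_suminf_AE_eq:
  assumes "has_ms_sum M X S"
  shows "AE \<omega> in M. ms_suminf M X \<omega> = S \<omega>"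
  unfolding ms_suminf_def using has_ms_sum_AE_unique[OF someI[where P="has_ms_sum M X", OF assms] assms] .

lemma second_order_ms_suminf:
  assumes "has_ms_sum M X S"
  shows "second_order M (ms_suminf M X)"
  unfolding ms_suminf_def using someI[where P="has_ms_sum M X", OF assms] by (simp add: has_ms_sum_def)

section \<open>Measurability of partial derivatives\<close>

lemma norm_sq_vec: "(norm v)\<^sup>2 = (\<Sum>i\<in>UNIV. (v $ i)\<^sup>2)" for v :: "real^'n"
  unfolding power2_norm_eq_inner inner_vec_def by (simp add: power2_eq_square)

text \<open>The eigenfunctions are only assumed differentiable, so their partial derivatives may be
  discontinuous; measurability comes from writing them as pointwise limits of difference quotients
  along a sequence. It is what allows sum and integral to be exchanged in the gradient
  energy.\<close>

lemma partial_borel_measurable: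
  fixes g :: "real^3 \<Rightarrow> real"
  assumes G: "open G" and g: "\<And>x. x \<in> G \<Longrightarrow> g differentiable (at x)"
  shows "(\<lambda>x. indicator G x * partial b g x) \<in> borel_measurable borel"
proof -
  \<comment> \<open>Extending \<open>g\<close> by zero gives a Borel function on the whole space, so
    that its translates are Borel as well.\<close>
  define F where "F x = indicator G x *\<^sub>R g x" for x
  have "continuous_on G g"
    using g by (simp add: differentiable_imp_continuous_on differentiable_on_def differentiable_at_withinI)
  then have [measurable]: "F \<in> borel_measurable borel"
    unfolding F_def[abs_def] using G by (intro borel_measurable_continuous_on_indicator) auto
  have [measurable]: "G \<in> sets borel" using G by simp
  define t :: "nat \<Rightarrow> real" where "t n = inverse (real (Suc n))" for n
  have lim: "(\<lambda>n. indicator G x * ((F (x + t n *\<^sub>R axis b 1) - F x) / t n))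
      \<longlonglongrightarrow> indicator G x * partial b g x" for x
  proof (cases "x \<in> G")
    case True
    have t0: "t \<longlonglongrightarrow> 0" unfolding t_def[abs_def] by (rule LIMSEQ_inverse_real_of_nat)
    have "(\<lambda>n. x + t n *\<^sub>R axis b 1) \<longlonglongrightarrow> x + 0 *\<^sub>R axis b 1"
      by (intro tendsto_intros t0)
    \<comment> \<open>From some index on the shifted point stays in the open set \<open>G\<close>,
      where \<open>F\<close> agrees with \<open>g\<close>.\<close>
    then have ev: "\<forall>\<^sub>F n in sequentially. x + t n *\<^sub>R axis b 1 \<in> G"
      using topological_tendstoD[OF _ G] True by simp
    have g': "(g has_derivative frechet_derivative g (at x)) (at x)"
      using g[OF True] by (simp add: frechet_derivative_works)
    have "((\<lambda>h. (g (x + h *\<^sub>R axis b 1) - g x) / h) \<longlongrightarrow> partial b g x) (at 0)"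
    proof -
      have line: "((\<lambda>h. x + h *\<^sub>R axis b 1) has_derivative (\<lambda>h. h *\<^sub>R axis b 1)) (at 0)"
        by (auto intro!: derivative_eq_intros)
      have "linear (frechet_derivative g (at x))"
        using g' has_derivative_linear by blast
      then have "frechet_derivative g (at x) (h *\<^sub>R axis b 1) = h * partial b g x" for h
        by (simp add: partial_def linear_scale)
      moreover have "((\<lambda>h. g (x + h *\<^sub>R axis b 1)) has_derivative
          (\<lambda>h. frechet_derivative g (at x) (h *\<^sub>R axis b 1))) (at 0)"
        using has_derivative_compose[OF line, of g] g' by simp
      ultimately have "((\<lambda>h. g (x + h *\<^sub>R axis b 1)) has_field_derivative partial b g x) (at 0)"
        by (simp add: has_field_derivative_def mult_commute_abs)
      then show ?thesis by (simp add: DERIV_def)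
    qed
    moreover have "filterlim t (at 0) sequentially"
      using t0 by (simp add: filterlim_at t_def)
    ultimately have "(\<lambda>n. (g (x + t n *\<^sub>R axis b 1) - g x) / t n) \<longlonglongrightarrow> partial b g x"
      by (rule filterlim_compose)
    then have "(\<lambda>n. indicator G x * ((F (x + t n *\<^sub>R axis b 1) - F x) / t n)) \<longlonglongrightarrow> partial b g x"
      by (rule Lim_transform_eventually) (use ev True in \<open>auto elim!: eventually_mono simp: F_def\<close>)
    then show ?thesis using True by simp
  qed simp
  show ?thesis
    by (rule borel_measurable_LIMSEQ_real[OF lim]) measurable
qed

section \<open>Orthonormality of the Gaussian coefficients\<close>

lemma indep_std_normal_orthonormal:
  assumes "prob_space M"
    and indep: "prob_space.indep_vars M (\<lambda>_. borel) \<xi> UNIV"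
    and normal: "\<And>I::nat. distributed M lborel (\<xi> I) (\<lambda>t. ennreal (std_normal_density t))"
  shows "second_order M (\<xi> I)"
    and "(LINT \<omega>|M. \<xi> I \<omega> * \<xi> J \<omega>) = (if I = J then 1 else 0)"
proof -
  interpret prob_space M by fact
  have so: "second_order M (\<xi> I)" for I
    using distributed_integrable[OF normal[of I], of "\<lambda>t. t\<^sup>2"] integrable_std_normal_moment[of 2]
      distributed_measurable[OF normal[of I]]
    by (simp add: second_order_def)
  show "second_order M (\<xi> I)" by (rule so)
  have E: "expectation (\<xi> I) = 0" for I
    using standard_normal_distributed_expectation[OF normal] .
  show "(LINT \<omega>|M. \<xi> I \<omega> * \<xi> J \<omega>) = (if I = J then 1 else 0)"
  proof (cases "I = J")
    case True
    then show ?thesis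
      using standard_normal_distributed_variance[OF normal[of J]] E by (simp add: power2_eq_square)
  next
    case False
    have int: "integrable M (\<xi> I)" for I
      using so[of I] square_integrable_imp_integrable by (auto simp: second_order_def)
    have "indep_vars (\<lambda>_. borel) \<xi> {I, J}"
      using indep by (rule indep_vars_subset) simp
    then have "(LINT \<omega>|M. (\<Prod>i\<in>{I, J}. \<xi> i \<omega>)) = (\<Prod>i\<in>{I, J}. expectation (\<xi> i))"
      by (rule indep_vars_lebesgue_integral[rotated]) (auto intro: int)
    then show ?thesis
      using E False by simp
  qed
qed

section \<open>Mean-square derivatives\<close>

text \<open>The limit on the left does not mention \<open>D\<close>, so any two mean-square
  derivatives of \<open>Y\<close> at \<open>x\<close> have the same second moment. This serves in
  place of their almost sure uniqueness.\<close>

lemma has_ms_partial_norm_tendsto: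
  assumes D: "has_ms_partial M Y b x D"
  shows "((\<lambda>h. LINT \<omega>|M. ((Y (x + h *\<^sub>R axis b 1) \<omega> - Y x \<omega>) / h)\<^sup>2)
    \<longlongrightarrow> (LINT \<omega>|M. (D \<omega>)\<^sup>2)) (at 0)"
proof (rule second_order_norm_tendsto)
  have "second_order M (\<lambda>\<omega>. (Y (x + h *\<^sub>R axis b 1) \<omega> - Y x \<omega>) / h)"
    if "second_order M (Y (x + h *\<^sub>R axis b 1))" for h
    using second_order_cmult[OF second_order_diff[OF that], of "Y x" "1 / h"] D
    by (simp add: has_ms_partial_def)
  then show "\<forall>\<^sub>F h in at 0. second_order M (\<lambda>\<omega>. (Y (x + h *\<^sub>R axis b 1) \<omega> - Y x \<omega>) / h)"
    using D unfolding has_ms_partial_def by (auto elim: eventually_mono)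
qed (use D in \<open>auto simp: has_ms_partial_def\<close>)

lemma eventually_line_in_open:
  fixes x e :: "'a::real_normed_vector"
  assumes "open G" "x \<in> G"
  shows "\<forall>\<^sub>F h in at (0::real). x + h *\<^sub>R e \<in> G"
proof -
  have "((\<lambda>h. x + h *\<^sub>R e) \<longlongrightarrow> x + 0 *\<^sub>R e) (at 0)"
    by (intro tendsto_intros)
  then show ?thesis using assms topological_tendstoD by fastforce
qed

text \<open>The constant \<open>d\<close> cancels in difference quotients and \<open>c\<close>
  factors out. The relation between \<open>W\<close> and \<open>Y\<close> is only almost sure, with
  a null set depending on the point, because the velocity is built from a chosen representative of
  the series. This suffices, since for each \<open>h\<close> only two points are involved.\<close>

lemma has_ms_partial_affine:
  assumes D: "has_ms_partial M Y b x D" and G: "open G" "x \<in> G"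
    and W: "\<And>y. y \<in> G \<Longrightarrow> second_order M (W y)"
    and ae: "\<And>y. y \<in> G \<Longrightarrow> AE \<omega> in M. W y \<omega> = d + c * Y y \<omega>"
  shows "has_ms_partial M W b x (\<lambda>\<omega>. c * D \<omega>)"
proof -
  note ev = eventually_line_in_open[OF G, of "axis b 1"]
  have so: "second_order M D" "second_order M (Y x)"
    and evY: "\<forall>\<^sub>F h in at 0. second_order M (Y (x + h *\<^sub>R axis b 1))"
    and lim: "((\<lambda>h. LINT \<omega>|M. ((Y (x + h *\<^sub>R axis b 1) \<omega> - Y x \<omega>) / h - D \<omega>)\<^sup>2) \<longlongrightarrow> 0) (at 0)"
    using D by (auto simp: has_ms_partial_def)
  have "\<forall>\<^sub>F h in at 0. c\<^sup>2 * (LINT \<omega>|M. ((Y (x + h *\<^sub>R axis b 1) \<omega> - Y x \<omega>) / h - D \<omega>)\<^sup>2) =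
      (LINT \<omega>|M. ((W (x + h *\<^sub>R axis b 1) \<omega> - W x \<omega>) / h - c * D \<omega>)\<^sup>2)"
    using ev evY
  proof eventually_elim
    case (elim h)
    let ?y = "x + h *\<^sub>R axis b 1"
    note [measurable] = so elim(2) W[OF G(2)] W[OF elim(1)]
    have "(LINT \<omega>|M. ((W ?y \<omega> - W x \<omega>) / h - c * D \<omega>)\<^sup>2) =
        (LINT \<omega>|M. c\<^sup>2 * ((Y ?y \<omega> - Y x \<omega>) / h - D \<omega>)\<^sup>2)"
    proof (rule integral_cong_AE)
      show "AE \<omega> in M. ((W ?y \<omega> - W x \<omega>) / h - c * D \<omega>)\<^sup>2 = c\<^sup>2 * ((Y ?y \<omega> - Y x \<omega>) / h - D \<omega>)\<^sup>2"
        using ae[OF elim(1)] ae[OF G(2)]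
      proof eventually_elim
        case (elim \<omega>)
        then have "(W ?y \<omega> - W x \<omega>) / h - c * D \<omega> = c * ((Y ?y \<omega> - Y x \<omega>) / h - D \<omega>)"
          by (simp add: algebra_simps diff_divide_distrib)
        then show ?case by (simp add: power_mult_distrib)
      qed
    qed measurable
    then show ?case by simp
  qed
  moreover have "((\<lambda>h. c\<^sup>2 * (LINT \<omega>|M. ((Y (x + h *\<^sub>R axis b 1) \<omega> - Y x \<omega>) / h - D \<omega>)\<^sup>2)) \<longlongrightarrow> c\<^sup>2 * 0) (at 0)"
    by (intro tendsto_intros lim)
  ultimately have "((\<lambda>h. LINT \<omega>|M. ((W (x + h *\<^sub>R axis b 1) \<omega> - W x \<omega>) / h - c * D \<omega>)\<^sup>2) \<longlongrightarrow> 0) (at 0)"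
    by (simp add: Lim_transform_eventually)
  then show ?thesis
    using second_order_cmult[OF so(1)] W[OF G(2)] eventually_mono[OF ev W]
    by (simp add: has_ms_partial_def)
qed

section \<open>Second moments of the gradient of the random field\<close>

context kl_gaussian_field
begin

text \<open>This is Parseval's identity for the orthonormal coefficients: it is evident for partial
  sums, and mean-square convergence carries second moments to the limit. The numbers
  \<open>g I\<close> will be the partial derivatives of the eigenfunctions at a fixed point.\<close>

lemma sums_second_moment:
  assumes D: "has_ms_sum M (\<lambda>I \<omega>. sqrt (Z I) * g I * \<xi> I \<omega>) D"
  shows "(\<lambda>I. Z I * (g I)\<^sup>2) sums expectation (\<lambda>\<omega>. (D \<omega>)\<^sup>2)"
proof -
  define c where "c I = sqrt (Z I) * g I" for I
  note on = indep_std_normal_orthonormal[OF prob_space_axioms \<xi>_indep \<xi>_normal]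
  have summand: "second_order M (\<lambda>\<omega>. c I * \<xi> I \<omega>)" for I
    by (intro second_order_cmult on)
  have S: "second_order M (\<lambda>\<omega>. \<Sum>I<n. c I * \<xi> I \<omega>)" for n
    by (intro second_order_sum summand)
  have D': "second_order M D" "(\<lambda>n. LINT \<omega>|M. (D \<omega> - (\<Sum>I<n. c I * \<xi> I \<omega>))\<^sup>2) \<longlonglongrightarrow> 0"
    using D by (auto simp: has_ms_sum_def c_def)
  have "(\<lambda>n. expectation (\<lambda>\<omega>. (\<Sum>I<n. c I * \<xi> I \<omega>)\<^sup>2)) \<longlonglongrightarrow> expectation (\<lambda>\<omega>. (D \<omega>)\<^sup>2)"
    by (rule second_order_norm_tendsto) (use S D' in \<open>auto simp: power2_commute[of "D _"]\<close>)
  moreover have "expectation (\<lambda>\<omega>. (\<Sum>I<n. c I * \<xi> I \<omega>)\<^sup>2) = (\<Sum>I<n. Z I * (g I)\<^sup>2)" for n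
  proof -
    have int: "integrable M (\<lambda>\<omega>. c I * \<xi> I \<omega> * (c J * \<xi> J \<omega>))" for I J
      by (intro second_order_mult_integrable summand)
    have "expectation (\<lambda>\<omega>. c I * \<xi> I \<omega> * (c J * \<xi> J \<omega>)) = (if I = J then Z I * (g I)\<^sup>2 else 0)" for I J
    proof -
      have "expectation (\<lambda>\<omega>. c I * \<xi> I \<omega> * (c J * \<xi> J \<omega>)) = expectation (\<lambda>\<omega>. c I * c J * (\<xi> I \<omega> * \<xi> J \<omega>))"
        by (simp add: mult.assoc mult.left_commute)
      also have "\<dots> = c I * c J * (if I = J then 1 else 0)"
        using on(2) by simp
      also have "\<dots> = (if I = J then Z I * (g I)\<^sup>2 else 0)"
        using less_imp_le[OF eigenvalue_pos, of I]
        by (auto simp: c_def power2_eq_square mult.assoc mult.left_commute)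
      finally show ?thesis .
    qed
    then show ?thesis
      using int by (simp add: power2_eq_square sum_product)
  qed
  ultimately show ?thesis by (simp add: sums_def)
qed

text \<open>By stationarity and isotropy the increments satisfy
  \<open>\<E>[(X (x + h e\<^sub>b) - X x)\<^sup>2] = 2 (k 0 - k \<bar>h\<bar>)\<close>, which depends neither on the point nor on the direction.\<close>

lemma derivative_variance_constant:
  assumes G: "open G" "G \<noteq> {}"
  obtains q where "q \<ge> 0"
    and "\<And>x b D. x \<in> G \<Longrightarrow> has_ms_partial M X b x D \<Longrightarrow> expectation (\<lambda>\<omega>. (D \<omega>)\<^sup>2) = q"
proof -
  obtain k where k: "\<And>x y. x \<in> G \<Longrightarrow> y \<in> G \<Longrightarrow> K lam x y = k (norm (x - y))"
    using isotropic by blast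
  have X: "second_order M (X x)" if "x \<in> G" for x
    using expansion[OF that] by (simp add: has_ms_sum_def)
  have lim: "((\<lambda>h. 2 * (k 0 - k \<bar>h\<bar>) / h\<^sup>2) \<longlongrightarrow> expectation (\<lambda>\<omega>. (D \<omega>)\<^sup>2)) (at 0)"
    if x: "x \<in> G" and D: "has_ms_partial M X b x D" for x b D
  proof (rule Lim_transform_eventually[OF has_ms_partial_norm_tendsto[OF D]])
    show "\<forall>\<^sub>F h in at 0. expectation (\<lambda>\<omega>. ((X (x + h *\<^sub>R axis b 1) \<omega> - X x \<omega>) / h)\<^sup>2) =
        2 * (k 0 - k \<bar>h\<bar>) / h\<^sup>2"
      using eventually_line_in_open[OF G(1) x, of "axis b 1"]
    proof eventually_elim
      case (elim h)
      let ?y = "x + h *\<^sub>R axis b 1"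
      have "expectation (\<lambda>\<omega>. ((X ?y \<omega> - X x \<omega>) / h)\<^sup>2) =
          expectation (\<lambda>\<omega>. (X ?y \<omega> * X ?y \<omega> - 2 * (X ?y \<omega> * X x \<omega>) + X x \<omega> * X x \<omega>) / h\<^sup>2)"
        by (rule Bochner_Integration.integral_cong)
           (simp_all add: power_divide power2_diff mult.assoc flip: power2_eq_square)
      also have "\<dots> = (K lam ?y ?y - 2 * K lam ?y x + K lam x x) / h\<^sup>2"
        using second_order_mult_integrable[OF X X] elim x by (simp add: covariance)
      also have "\<dots> = 2 * (k 0 - k \<bar>h\<bar>) / h\<^sup>2"
        using elim x by (simp add: k norm_axis_1)
      finally show ?case .
    qed
  qed
  obtain x0 where x0: "x0 \<in> G" using G(2) by blast
  \<comment> \<open>Any direction serves for the reference value; \<open>undefined\<close> is an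
    arbitrary one.\<close>
  obtain D0 where D0: "has_ms_partial M X undefined x0 D0"
    using termwise_derivative[OF x0] by blast
  show ?thesis
  proof
    show "0 \<le> expectation (\<lambda>\<omega>. (D0 \<omega>)\<^sup>2)" by simp
    show "expectation (\<lambda>\<omega>. (D \<omega>)\<^sup>2) = expectation (\<lambda>\<omega>. (D0 \<omega>)\<^sup>2)"
      \<comment> \<open>Both second moments are limits of the same function of
        \<open>h\<close>.\<close>
      if "x \<in> G" "has_ms_partial M X b x D" for x b D
      using tendsto_unique[OF _ lim[OF that] lim[OF x0 D0]] by simp
  qed
qed

text \<open>At each point of \<open>G\<close>, Parseval applied to the termwise derivative gives
  \<open>q\<close> in each of the three directions, hence \<open>3 * q\<close> for the gradient. All
  terms are nonnegative, so the sum may be moved under the integral, leaving a constant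
  integrand.\<close>

lemma kl_grad_energy_eq:
  assumes G: "open G"
    and q: "q \<ge> 0" "\<And>x b D. x \<in> G \<Longrightarrow> has_ms_partial M X b x D \<Longrightarrow> expectation (\<lambda>\<omega>. (D \<omega>)\<^sup>2) = q"
  shows "kl_grad_energy G Z f = ennreal (3 * q) * emeasure lborel G"
proof -
  have sums: "(\<lambda>I. Z I * (norm (grad (f I) x))\<^sup>2) sums (3 * q)" if x: "x \<in> G" for x
  proof -
    have "(\<lambda>I. Z I * (partial b (f I) x)\<^sup>2) sums q" for b
    proof -
      obtain D where "has_ms_partial M X b x D"
        "has_ms_sum M (\<lambda>I \<omega>. sqrt (Z I) * partial b (f I) x * \<xi> I \<omega>) D"
        using termwise_derivative[OF x] by blast
      then show ?thesis using sums_second_moment[of "\<lambda>I. partial b (f I) x" D] q(2)[OF x] by simp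
    qed
    then have "(\<lambda>I. \<Sum>b\<in>UNIV. Z I * (partial b (f I) x)\<^sup>2) sums (\<Sum>b\<in>(UNIV::3 set). q)"
      by (intro sums_sum)
    then show ?thesis
      by (simp add: grad_def norm_sq_vec sum_distrib_left)
  qed
  have meas: "(\<lambda>x. ennreal ((norm (grad (f I) x))\<^sup>2) * indicator G x) \<in> borel_measurable lborel" for I
  proof -
    have [measurable]: "(\<lambda>x. indicator G x * partial b (f I) x) \<in> borel_measurable borel" for b
      using partial_borel_measurable[OF G eigenfunction_diff] .
    have "(\<lambda>x. ennreal ((norm (grad (f I) x))\<^sup>2) * indicator G x) =
        (\<lambda>x. ennreal (\<Sum>b\<in>UNIV. (indicator G x * partial b (f I) x)\<^sup>2))"
      by (auto simp: fun_eq_iff grad_def norm_sq_vec split: split_indicator)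
    then show ?thesis by simp
  qed
  have "kl_grad_energy G Z f =
      (\<Sum>I. \<integral>\<^sup>+ x. ennreal (Z I) * (ennreal ((norm (grad (f I) x))\<^sup>2) * indicator G x) \<partial>lborel)"
    unfolding kl_grad_energy_def by (subst nn_integral_cmult[OF meas]) simp
  also have "\<dots> = (\<integral>\<^sup>+ x. (\<Sum>I. ennreal (Z I) * (ennreal ((norm (grad (f I) x))\<^sup>2) * indicator G x)) \<partial>lborel)"
    by (rule nn_integral_suminf[symmetric]) (use meas in measurable)
  also have "\<dots> = (\<integral>\<^sup>+ x. ennreal (3 * q) * indicator G x \<partial>lborel)"
  proof (rule nn_integral_cong)
    fix x
    show "(\<Sum>I. ennreal (Z I) * (ennreal ((norm (grad (f I) x))\<^sup>2) * indicator G x)) =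
        ennreal (3 * q) * indicator G x"
    proof (cases "x \<in> G")
      case True
      have "ennreal (Z I) * ennreal ((norm (grad (f I) x))\<^sup>2) = ennreal (Z I * (norm (grad (f I) x))\<^sup>2)" for I
        using less_imp_le[OF eigenvalue_pos, of I] by (simp add: ennreal_mult)
      moreover have "(\<Sum>I. ennreal (Z I * (norm (grad (f I) x))\<^sup>2)) = ennreal (3 * q)"
        by (rule suminf_ennreal_eq[OF _ sums[OF True]]) (simp add: less_imp_le[OF eigenvalue_pos])
      ultimately show ?thesis
        using True by simp
    qed simp
  qed
  also have "\<dots> = ennreal (3 * q) * emeasure lborel G"
    using G by (simp add: nn_integral_cmult_indicator)
  finally show ?thesis .
qed

text \<open>Each component is almost surely an affine function of \<open>X\<close>, with slope
  \<open>c a\<close>. Its derivatives thus have second moment \<open>(c a)\<^sup>2 * q\<close>;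
  summing over \<open>a\<close> produces \<open>(norm u)\<^sup>2\<close>, and over the three
  directions the factor 3.\<close>

lemma mean_grad_sq_turbulent_velocity:
  assumes G: "open G" and x: "x \<in> G"
    and q: "q \<ge> 0" "\<And>x b D. x \<in> G \<Longrightarrow> has_ms_partial M X b x D \<Longrightarrow> expectation (\<lambda>\<omega>. (D \<omega>)\<^sup>2) = q"
  shows "mean_grad_sq M (turbulent_velocity M Z f \<xi> u A \<beta> REc RE) x =
    ennreal (A\<^sup>2 * (norm u)\<^sup>2 * (3 * q) * ((RE - REc) powr \<beta>)\<^sup>2)"
proof -
  define V where "V = turbulent_velocity M Z f \<xi> u A \<beta> REc RE"
  define c where "c a = A * u $ a * (RE - REc) powr \<beta>" for a
  have V: "V a y = (\<lambda>\<omega>. u $ a + c a * ms_suminf M (\<lambda>I \<omega>. sqrt (Z I) * f I y * \<xi> I \<omega>) \<omega>)" for a y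
    by (simp add: V_def turbulent_velocity_def c_def fun_eq_iff)
  have const: "second_order M (\<lambda>_. d)" for d
    by (simp add: second_order_def)
  have der: "second_order M (ms_partial M (V a) b x) \<and>
      expectation (\<lambda>\<omega>. (ms_partial M (V a) b x \<omega>)\<^sup>2) = (c a)\<^sup>2 * q" for a b
  proof -
    obtain D where D: "has_ms_partial M X b x D"
      using termwise_derivative[OF x] by blast
    have cD: "has_ms_partial M (V a) b x (\<lambda>\<omega>. c a * D \<omega>)"
    proof (rule has_ms_partial_affine[OF D G x])
      show "second_order M (V a y)" if "y \<in> G" for y
        unfolding V
        by (intro second_order_add second_order_cmult const second_order_ms_suminf[OF expansion[OF that]])
      show "AE \<omega> in M. V a y \<omega> = u $ a + c a * X y \<omega>" if "y \<in> G" for y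
        unfolding V using ms_suminf_AE_eq[OF expansion[OF that]] by eventually_elim simp
    qed
    \<comment> \<open>One derivative exists, so the choice operator in \<open>ms_partial\<close>
      returns a genuine one. It need not be \<open>c a * D\<close>, but its second moment is the
      same.\<close>
    then have P: "has_ms_partial M (V a) b x (ms_partial M (V a) b x)"
      unfolding ms_partial_def by (rule someI[where P="has_ms_partial M (V a) b x"])
    have "expectation (\<lambda>\<omega>. (ms_partial M (V a) b x \<omega>)\<^sup>2) = expectation (\<lambda>\<omega>. (c a * D \<omega>)\<^sup>2)"
      using tendsto_unique[OF _ has_ms_partial_norm_tendsto[OF P] has_ms_partial_norm_tendsto[OF cD]] by simp
    also have "\<dots> = (c a)\<^sup>2 * q"
      using q(2)[OF x D] by (simp add: power_mult_distrib)
    finally show ?thesis using P by (simp add: has_ms_partial_def)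
  qed
  have int: "integrable M (\<lambda>\<omega>. (ms_partial M (V a) b x \<omega>)\<^sup>2)" for a b
    using der second_order_square_integrable by blast
  have "mean_grad_sq M V x = ennreal (expectation (\<lambda>\<omega>. \<Sum>a\<in>UNIV. \<Sum>b\<in>UNIV. (ms_partial M (V a) b x \<omega>)\<^sup>2))"
    unfolding mean_grad_sq_def using int
    by (subst nn_integral_eq_integral[symmetric]) (auto intro!: sum_nonneg)
  also have "expectation (\<lambda>\<omega>. \<Sum>a\<in>UNIV. \<Sum>b\<in>UNIV. (ms_partial M (V a) b x \<omega>)\<^sup>2) =
      (\<Sum>a\<in>UNIV. \<Sum>b\<in>(UNIV::3 set). (c a)\<^sup>2 * q)"
    using int der by simp
  also have "\<dots> = A\<^sup>2 * (norm u)\<^sup>2 * (3 * q) * ((RE - REc) powr \<beta>)\<^sup>2"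
    by (simp add: c_def power_mult_distrib norm_sq_vec sum_distrib_left sum_distrib_right mult_ac)
  finally show ?thesis by (simp add: V_def)
qed

end

section \<open>The limit of vanishing viscosity\<close>

lemma eventually_reynolds_gt:
  assumes "L > 0" "u \<noteq> 0" "REc > 0"
  shows "\<forall>\<^sub>F \<nu> in at_right 0. \<nu> > 0 \<and> reynolds u L \<nu> > REc"
proof -
  have "norm u * L / REc > 0" using assms by simp
  then have "\<forall>\<^sub>F \<nu> in at_right 0. \<nu> < norm u * L / REc"
    by (rule order_tendstoD(2)[OF tendsto_ident_at])
  with eventually_at_right_less[of 0] show ?thesis
    by eventually_elim (use assms in \<open>auto simp: reynolds_def field_simps\<close>)
qed

text \<open>With \<open>c = norm u * L\<close> one has
  \<open>RE - REc = (c - REc * \<nu>) / \<nu>\<close>, so the expression is the product of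
  \<open>\<nu> powr (1 - 2 * \<beta>)\<close> and
  \<open>(c - REc * \<nu>) powr (2 * \<beta>)\<close>. The second factor has a positive limit; the
  first decides between the two cases.\<close>

lemma viscosity_scaling_tendsto:
  assumes "L > 0" "u \<noteq> 0" "REc > 0" "\<beta> \<le> 1 / 2"
  shows "((\<lambda>\<nu>. \<nu> * ((reynolds u L \<nu> - REc) powr \<beta>)\<^sup>2) \<longlongrightarrow> (if \<beta> = 1 / 2 then norm u * L else 0)) (at_right 0)"
proof -
  define c where "c = norm u * L"
  have c: "c > 0" using assms by (simp add: c_def)
  have eq: "\<forall>\<^sub>F \<nu> in at_right 0. \<nu> powr (1 - 2 * \<beta>) * (c - REc * \<nu>) powr (2 * \<beta>) =
      \<nu> * ((reynolds u L \<nu> - REc) powr \<beta>)\<^sup>2"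
    using eventually_reynolds_gt[OF assms(1-3)]
  proof eventually_elim
    case (elim \<nu>)
    then have pos: "\<nu> > 0" "c - REc * \<nu> > 0" by (auto simp: reynolds_def c_def field_simps)
    have "reynolds u L \<nu> - REc = (c - REc * \<nu>) / \<nu>"
      using pos by (simp add: reynolds_def c_def field_simps)
    then have "((reynolds u L \<nu> - REc) powr \<beta>)\<^sup>2 = ((c - REc * \<nu>) / \<nu>) powr (2 * \<beta>)"
      by (simp add: power2_eq_square flip: powr_add)
    also have "\<dots> = (c - REc * \<nu>) powr (2 * \<beta>) / \<nu> powr (2 * \<beta>)"
      using pos by (simp add: powr_divide)
    finally show ?case using pos by (simp add: powr_diff)
  qed
  have "((\<lambda>\<nu>. \<nu> powr (1 - 2 * \<beta>)) \<longlongrightarrow> (if \<beta> = 1 / 2 then 1 else 0)) (at_right 0)"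
  proof (cases "\<beta> = 1 / 2")
    \<comment> \<open>Here the exponent is 0. Since \<open>0 powr 0 = 0\<close>, the limit cannot be
      read off at \<open>\<nu> = 0\<close>; the factor is 1 for every positive
      \<open>\<nu>\<close>.\<close>
    case True
    have "\<forall>\<^sub>F \<nu> in at_right 0. 1 = \<nu> powr (1 - 2 * \<beta>)"
      using eventually_at_right_less[of "0::real"] by eventually_elim (simp add: True)
    then have "((\<lambda>\<nu>. \<nu> powr (1 - 2 * \<beta>)) \<longlongrightarrow> 1) (at_right 0)"
      by (rule Lim_transform_eventually[OF tendsto_const])
    then show ?thesis by (subst if_P[OF True])
  next
    case False
    then have "((\<lambda>\<nu>. \<nu> powr (1 - 2 * \<beta>)) \<longlongrightarrow> 0 powr (1 - 2 * \<beta>)) (at_right 0)"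
      using assms(4) eventually_at_right_less[of "0::real"]
      by (intro tendsto_powr' tendsto_intros) (auto elim: eventually_mono)
    then show ?thesis using False by simp
  qed
  moreover have "((\<lambda>\<nu>. (c - REc * \<nu>) powr (2 * \<beta>)) \<longlongrightarrow> (c - REc * 0) powr (2 * \<beta>)) (at_right 0)"
    using c by (intro tendsto_intros) auto
  ultimately have "((\<lambda>\<nu>. \<nu> powr (1 - 2 * \<beta>) * (c - REc * \<nu>) powr (2 * \<beta>)) \<longlongrightarrow>
      (if \<beta> = 1 / 2 then 1 else 0) * (c - REc * 0) powr (2 * \<beta>)) (at_right 0)"
    by (rule tendsto_mult)
  moreover have "(if \<beta> = 1 / 2 then 1 else 0) * (c - REc * 0) powr (2 * \<beta>) = (if \<beta> = 1 / 2 then c else 0)"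
  proof (cases "\<beta> = 1 / 2")
    case True
    show ?thesis unfolding True using c by simp
  qed simp
  ultimately have "((\<lambda>\<nu>. \<nu> powr (1 - 2 * \<beta>) * (c - REc * \<nu>) powr (2 * \<beta>)) \<longlongrightarrow>
      (if \<beta> = 1 / 2 then c else 0)) (at_right 0)"
    by (simp only:)
  from Lim_transform_eventually[OF this eq] show ?thesis
    unfolding c_def .
qed

text \<open>All three laws have this shape: \<open>s\<close> is \<open>3 * q\<close> or the gradient
  energy, and \<open>c\<close> collects the positive constants. The true limit is always
  \<open>?l\<close>, so each law reduces to uniqueness of limits. In the second claim
  \<open>s > 0\<close> stands on the left too, since for \<open>s = 0\<close> the convergence holds
  trivially with limit 0.\<close>

lemma limit_law_iff:
  assumes params: "L > 0" "u \<noteq> 0" "REc > 0" "\<beta> \<le> 1 / 2" and c: "c > 0" and s: "s \<ge> 0"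
    and F: "\<And>\<nu>. \<nu> > 0 \<Longrightarrow> reynolds u L \<nu> > REc \<Longrightarrow>
      F \<nu> = ennreal (c * s * ((reynolds u L \<nu> - REc) powr \<beta>)\<^sup>2)"
  shows "(\<exists>l>0. ((\<lambda>\<nu>. ennreal \<nu> * F \<nu>) \<longlongrightarrow> ennreal l) (at_right 0)) \<longleftrightarrow> \<beta> = 1 / 2 \<and> s > 0"
    and "((\<lambda>\<nu>. ennreal \<nu> * F \<nu>) \<longlongrightarrow> ennreal (c * (norm u * L) * s)) (at_right 0) \<and> s > 0 \<longleftrightarrow> \<beta> = 1 / 2 \<and> s > 0"
proof -
  let ?l = "c * s * (if \<beta> = 1 / 2 then norm u * L else 0)"
  \<comment> \<open>The formula for \<open>F\<close> is available only above the critical Reynolds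
    number, which is reached for all small \<open>\<nu>\<close>.\<close>
  have "\<forall>\<^sub>F \<nu> in at_right 0. ennreal (c * s * (\<nu> * ((reynolds u L \<nu> - REc) powr \<beta>)\<^sup>2)) = ennreal \<nu> * F \<nu>"
    using eventually_reynolds_gt[OF params(1-3)]
    by eventually_elim (use c s in \<open>simp add: F mult_ac flip: ennreal_mult'\<close>)
  moreover have "((\<lambda>\<nu>. ennreal (c * s * (\<nu> * ((reynolds u L \<nu> - REc) powr \<beta>)\<^sup>2))) \<longlongrightarrow> ennreal ?l) (at_right 0)"
    by (intro tendsto_ennrealI tendsto_mult tendsto_const viscosity_scaling_tendsto params)
  ultimately have lim: "((\<lambda>\<nu>. ennreal \<nu> * F \<nu>) \<longlongrightarrow> ennreal ?l) (at_right 0)"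
    by (rule Lim_transform_eventually[rotated])
  have l0: "?l \<ge> 0" using c s params by simp
  have pos: "norm u * L > 0" using params by simp
  \<comment> \<open>\<open>ennreal\<close> is injective on nonnegative reals, so equality of limits
    gives equality of the real numbers.\<close>
  have iff: "((\<lambda>\<nu>. ennreal \<nu> * F \<nu>) \<longlongrightarrow> ennreal l) (at_right 0) \<longleftrightarrow> l = ?l" if "l > 0" for l
    using tendsto_unique[OF _ lim, of "ennreal l"] lim that l0 by auto
  show "(\<exists>l>0. ((\<lambda>\<nu>. ennreal \<nu> * F \<nu>) \<longlongrightarrow> ennreal l) (at_right 0)) \<longleftrightarrow> \<beta> = 1 / 2 \<and> s > 0"
  proof -
    have "(\<exists>l>0. ((\<lambda>\<nu>. ennreal \<nu> * F \<nu>) \<longlongrightarrow> ennreal l) (at_right 0)) \<longleftrightarrow> ?l > 0"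
      using iff by blast
    also have "0 < c * s * (if \<beta> = 1 / 2 then p else 0) \<longleftrightarrow> \<beta> = 1 / 2 \<and> s > 0" if "p > 0" for p
      using c s that by (auto simp: zero_less_mult_iff)
    note this[OF pos]
    finally show ?thesis .
  qed
  show "((\<lambda>\<nu>. ennreal \<nu> * F \<nu>) \<longlongrightarrow> ennreal (c * (norm u * L) * s)) (at_right 0) \<and> s > 0 \<longleftrightarrow> \<beta> = 1 / 2 \<and> s > 0"
  proof (cases "s > 0")
    case True
    then have p: "c * (norm u * L) * s > 0" using c pos by simp
    show ?thesis unfolding iff[OF p] using True p by (auto simp: mult_ac)
  qed simp
qed

section \<open>The three dissipation laws\<close>

theorem theorem5p4:
  fixes M :: "'w measure"
    and G :: "(real^3) set"
    and K :: "real \<Rightarrow> real^3 \<Rightarrow> real^3 \<Rightarrow> real"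
    and lam L A REc T \<beta> :: real
    and Z :: "nat \<Rightarrow> real"
    and f :: "nat \<Rightarrow> real^3 \<Rightarrow> real"
    and \<xi> :: "nat \<Rightarrow> 'w \<Rightarrow> real"
    and X :: "real^3 \<Rightarrow> 'w \<Rightarrow> real"
    and u :: "real^3"
    and U :: "real \<Rightarrow> 3 \<Rightarrow> real^3 \<Rightarrow> 'w \<Rightarrow> real"
  assumes domain: "open G" "connected G" "G \<noteq> {}" "bounded G"
    and field: "kl_gaussian_field M G K lam Z f \<xi> X"
    and params: "L > 0" "u \<noteq> 0" "A \<noteq> 0" "REc > 0" "T > 0" "\<beta> \<le> 1 / 2"
    and velocity: "\<And>\<nu>. \<nu> > 0 \<Longrightarrow> reynolds u L \<nu> > REc \<Longrightarrow>
           U \<nu> = turbulent_velocity M Z f \<xi> u A \<beta> REc (reynolds u L \<nu>)"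
  shows "((\<forall>x\<in>G. \<exists>l::real. l > 0 \<and>
             ((\<lambda>\<nu>. ennreal \<nu> * mean_grad_sq M (U \<nu>) x) \<longlongrightarrow> ennreal l) (at_right 0))
          \<longleftrightarrow> \<beta> = 1 / 2 \<and> 0 < kl_grad_energy G Z f \<and> kl_grad_energy G Z f < \<infinity>)
       \<and> ((((\<lambda>\<nu>. ennreal \<nu> * (\<integral>\<^sup>+ x\<in>G. mean_grad_sq M (U \<nu>) x \<partial>lborel))
               \<longlongrightarrow> ennreal (A\<^sup>2 * norm u ^ 3 * L) * kl_grad_energy G Z f) (at_right 0)
            \<and> 0 < ennreal (A\<^sup>2 * norm u ^ 3 * L) * kl_grad_energy G Z f)
          \<longleftrightarrow> \<beta> = 1 / 2 \<and> 0 < kl_grad_energy G Z f \<and> kl_grad_energy G Z f < \<infinity>)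
       \<and> ((((\<lambda>\<nu>. ennreal \<nu> *
                 (\<integral>\<^sup>+ s\<in>{0..T}. (\<integral>\<^sup>+ x\<in>G. mean_grad_sq M (U \<nu>) x \<partial>lborel) \<partial>lborel))
               \<longlongrightarrow> ennreal (A\<^sup>2 * norm u ^ 3 * L * T) * kl_grad_energy G Z f) (at_right 0)
            \<and> 0 < ennreal (A\<^sup>2 * norm u ^ 3 * L * T) * kl_grad_energy G Z f)
          \<longleftrightarrow> \<beta> = 1 / 2 \<and> 0 < kl_grad_energy G Z f \<and> kl_grad_energy G Z f < \<infinity>)"
proof -
  interpret kl_gaussian_field M G K lam Z f \<xi> X by (fact field)
  obtain q where q: "q \<ge> 0"
    "\<And>x b D. x \<in> G \<Longrightarrow> has_ms_partial M X b x D \<Longrightarrow> expectation (\<lambda>\<omega>. (D \<omega>)\<^sup>2) = q"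
    using derivative_variance_constant[OF domain(1,3)] by blast
  define V where "V = measure lborel G"
  have fin: "emeasure lborel G < \<infinity>" using domain(4) by (rule emeasure_bounded_finite)
  then have V: "emeasure lborel G = ennreal V"
    by (simp add: V_def emeasure_eq_ennreal_measure)
  \<comment> \<open>A nonempty open set is not Lebesgue negligible.\<close>
  have "emeasure lborel G \<noteq> 0"
    using open_not_negligible[OF domain(1,3)] domain(1) null_sets_completionI[of G lborel]
    by (auto simp: negligible_iff_null_sets null_sets_def[of lborel])
  with V have V_pos: "V > 0" by (cases "V > 0") (auto simp: ennreal_neg)
  have energy: "kl_grad_energy G Z f = ennreal (3 * q * V)"
    using kl_grad_energy_eq[OF domain(1) q] q(1) V_pos by (simp add: V ennreal_mult)
  define c where "c = A\<^sup>2 * (norm u)\<^sup>2"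
  have c: "c > 0" using params by (simp add: c_def)
  define r where "r \<nu> = ((reynolds u L \<nu> - REc) powr \<beta>)\<^sup>2" for \<nu>
  have point: "mean_grad_sq M (U \<nu>) x = ennreal (c * (3 * q) * r \<nu>)"
    if "\<nu> > 0" "reynolds u L \<nu> > REc" "x \<in> G" for \<nu> x
    using mean_grad_sq_turbulent_velocity[OF domain(1) that(3) q] velocity[OF that(1,2)]
    by (simp add: c_def r_def)
  have space: "(\<integral>\<^sup>+ x\<in>G. mean_grad_sq M (U \<nu>) x \<partial>lborel) = ennreal (c * (3 * q * V) * r \<nu>)"
    if \<nu>: "\<nu> > 0" "reynolds u L \<nu> > REc" for \<nu>
  proof -
    have "(\<integral>\<^sup>+ x\<in>G. mean_grad_sq M (U \<nu>) x \<partial>lborel) = (\<integral>\<^sup>+ x. ennreal (c * (3 * q) * r \<nu>) * indicator G x \<partial>lborel)"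
      by (rule nn_integral_cong) (simp add: point[OF \<nu>] split: split_indicator)
    also have "\<dots> = ennreal (c * (3 * q) * r \<nu>) * ennreal V"
      using domain(1) by (simp add: nn_integral_cmult_indicator V)
    also have "\<dots> = ennreal (c * (3 * q * V) * r \<nu>)"
      using V_pos by (subst ennreal_mult''[symmetric]) (simp_all add: mult_ac)
    finally show ?thesis .
  qed
  \<comment> \<open>The inner integral is constant in \<open>s\<close>, so the time integral
    contributes a factor \<open>T\<close>, which joins the constant \<open>c\<close>.\<close>
  have time: "(\<integral>\<^sup>+ s\<in>{0..T}. (\<integral>\<^sup>+ x\<in>G. mean_grad_sq M (U \<nu>) x \<partial>lborel) \<partial>lborel) =
      ennreal (c * T * (3 * q * V) * r \<nu>)"
    if \<nu>: "\<nu> > 0" "reynolds u L \<nu> > REc" for \<nu>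
    using params(5) unfolding space[OF \<nu>]
    by (simp add: nn_integral_cmult_indicator) (subst ennreal_mult''[symmetric], simp_all add: mult_ac)
  have cT: "c * T > 0" using c params(5) by simp
  have cL: "c * (norm u * L) > 0" and cTL: "c * T * (norm u * L) > 0"
    using c cT params by simp_all
  have s: "3 * q \<ge> 0" "3 * q * V \<ge> 0" using q(1) V_pos by simp_all
  note law = limit_law_iff[OF params(1,2,4,6)]
  \<comment> \<open>The energy is the real number \<open>3 * q * V\<close> with
    \<open>V > 0\<close>, so its positivity is that of \<open>q\<close>.\<close>
  have rhs: "\<beta> = 1 / 2 \<and> 0 < kl_grad_energy G Z f \<and> kl_grad_energy G Z f < \<infinity> \<longleftrightarrow> \<beta> = 1 / 2 \<and> 3 * q > 0"
    using V_pos by (simp add: energy zero_less_mult_iff)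
  have "(\<forall>x\<in>G. \<exists>l::real. l > 0 \<and> ((\<lambda>\<nu>. ennreal \<nu> * mean_grad_sq M (U \<nu>) x) \<longlongrightarrow> ennreal l) (at_right 0))
      \<longleftrightarrow> \<beta> = 1 / 2 \<and> 3 * q > 0"
  proof -
    have "(\<exists>l>0. ((\<lambda>\<nu>. ennreal \<nu> * mean_grad_sq M (U \<nu>) x) \<longlongrightarrow> ennreal l) (at_right 0))
        \<longleftrightarrow> \<beta> = 1 / 2 \<and> 3 * q > 0" if "x \<in> G" for x
      by (rule law(1)[OF c s(1)]) (use that point in \<open>simp add: r_def\<close>)
    \<comment> \<open>The criterion is the same at every point, and \<open>G\<close> has a
      point.\<close>
    then show ?thesis using domain(3) by blast
  qed
  moreover have "((\<lambda>\<nu>. ennreal \<nu> * (\<integral>\<^sup>+ x\<in>G. mean_grad_sq M (U \<nu>) x \<partial>lborel))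
        \<longlongrightarrow> ennreal (A\<^sup>2 * norm u ^ 3 * L) * kl_grad_energy G Z f) (at_right 0)
      \<and> 0 < ennreal (A\<^sup>2 * norm u ^ 3 * L) * kl_grad_energy G Z f \<longleftrightarrow> \<beta> = 1 / 2 \<and> 3 * q > 0"
  proof -
    have "ennreal (A\<^sup>2 * norm u ^ 3 * L) * kl_grad_energy G Z f = ennreal (c * (norm u * L) * (3 * q * V))"
      unfolding energy
      by (subst ennreal_mult''[symmetric]) (use s in \<open>simp_all add: c_def power2_eq_square power3_eq_cube mult_ac\<close>)
    \<comment> \<open>Positivity of the prescribed limit is what \<open>limit_law_iff\<close>
      expresses as \<open>s > 0\<close>.\<close>
    moreover have "0 < ennreal (c * (norm u * L) * (3 * q * V)) \<longleftrightarrow> 3 * q * V > 0"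
      unfolding ennreal_less_zero_iff by (meson cL mult_pos_pos zero_less_mult_pos)
    ultimately show ?thesis
      using law(2)[OF c s(2) space[unfolded r_def]] V_pos by (simp add: zero_less_mult_iff)
  qed
  moreover have "((\<lambda>\<nu>. ennreal \<nu> *
        (\<integral>\<^sup>+ s\<in>{0..T}. (\<integral>\<^sup>+ x\<in>G. mean_grad_sq M (U \<nu>) x \<partial>lborel) \<partial>lborel))
        \<longlongrightarrow> ennreal (A\<^sup>2 * norm u ^ 3 * L * T) * kl_grad_energy G Z f) (at_right 0)
      \<and> 0 < ennreal (A\<^sup>2 * norm u ^ 3 * L * T) * kl_grad_energy G Z f \<longleftrightarrow> \<beta> = 1 / 2 \<and> 3 * q > 0"
  proof -
    have "ennreal (A\<^sup>2 * norm u ^ 3 * L * T) * kl_grad_energy G Z f =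
        ennreal (c * T * (norm u * L) * (3 * q * V))"
      unfolding energy
      by (subst ennreal_mult''[symmetric]) (use s in \<open>simp_all add: c_def power2_eq_square power3_eq_cube mult_ac\<close>)
    moreover have "0 < ennreal (c * T * (norm u * L) * (3 * q * V)) \<longleftrightarrow> 3 * q * V > 0"
      unfolding ennreal_less_zero_iff by (meson cTL mult_pos_pos zero_less_mult_pos)
    ultimately show ?thesis
      using law(2)[OF cT s(2) time[unfolded r_def]] V_pos by (simp add: zero_less_mult_iff)
  qed
  ultimately show ?thesis unfolding rhs by blast
qed

end
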